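(* Suppose that either (i) $n=2t$ and $2^{n-1}<N\le 2^{n-1}+\tfrac12\binom{n}{t}-t$, or (ii) $n=2t+1$ and $2^{n-1}<N\le 2^{n-1}+\binom{n-1}{t-1}-t-1$. Then there exists a family $\mathcal{A}\subset\mathcal{P}([n])$ of size $N$ which, for every $s$, contains the maximal number of intersecting subfamilies of size $s$ among all families in $\mathcal{P}([n])$ of size $N$, and which is not of the form $[n]^{(\ge t+1)}\cup\mathcal{B}$ for any $\mathcal{B}\subset[n]^{(t)}$.
   Context: $[n]=\{1,\dots,n\}$, $\mathcal{P}([n])$ its power set, $[n]^{(t)}$ the $t$-element subsets, $[n]^{(\ge t)}$ the subsets of size at least $t$. A family is intersecting if any two of its members have nonempty intersection. *)

theory Defs
  imports Complex_Main "HOL-Library.Ramsey"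
begin

(* The two members may coincide, so an intersecting family never contains the empty set. *)
definition intersecting :: "'a set set \<Rightarrow> bool" where
  "intersecting F \<longleftrightarrow> (\<forall>X\<in>F. \<forall>Y\<in>F. X \<inter> Y \<noteq> {})"

definition intersecting_count :: "'a set set \<Rightarrow> nat \<Rightarrow> nat" where
  "intersecting_count \<A> s = card {F. F \<subseteq> \<A> \<and> card F = s \<and> intersecting F}"

(* The t-element subsets of S are the library's nsets S t, written [S]\<^bsup>t\<^esup>. *)
definition subsets_ge :: "'a set \<Rightarrow> nat \<Rightarrow> 'a set set" where
  "subsets_ge S t = {X. X \<subseteq> S \<and> t \<le> card X}"

end

theory Submission
  imports Defs
begin

text \<open>
  A family of size \<open>2^(n-1) + m\<close> contains at least \<open>m\<close> complementary pairs, so its disjointness graph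
  contains a matching with \<open>m\<close> edges. A family whose disjointness graph is exactly such a matching
  is therefore optimal for all \<open>s\<close> simultaneously. This happens as soon as the family meets every
  complementary pair and its only disjoint pairs are complementary. Such a family may contain a set
  \<open>Z\<close> of size \<open>t - 1\<close>: keep \<open>Z\<close> and its complement \<open>Y\<close>, and drop all proper subsets of \<open>Y\<close>; when
  \<open>n = 2t + 1\<close>, the \<open>t\<close>-sets must moreover share a point \<open>e\<close> of \<open>Z\<close>.
\<close>

section \<open>Families with few disjoint pairs\<close>

text \<open>Of the two sets in a complementary pair exactly one contains \<open>e\<close>; choosing
  that one makes each pair lying inside \<open>F\<close> count once.\<close>

definition paired :: "'a set \<Rightarrow> 'a \<Rightarrow> 'a set set \<Rightarrow> 'a set set" where
  "paired S e F = {X \<in> F. e \<in> X \<and> S - X \<in> F}"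

definition covers_pairs :: "'a set \<Rightarrow> 'a set set \<Rightarrow> bool" where
  "covers_pairs S F \<longleftrightarrow> (\<forall>X. X \<subseteq> S \<longrightarrow> X \<in> F \<or> S - X \<in> F)"

text \<open>This says that the disjointness graph on \<open>F\<close> is a matching by complements.
  The case \<open>X = Y\<close> also keeps the empty set out of \<open>F\<close> when
  \<open>S\<close> is nonempty.\<close>

definition only_complementary_disjoint :: "'a set \<Rightarrow> 'a set set \<Rightarrow> bool" where
  "only_complementary_disjoint S F \<longleftrightarrow> (\<forall>X\<in>F. \<forall>Y\<in>F. X \<inter> Y = {} \<longrightarrow> Y = S - X)"

section \<open>Counting complementary pairs\<close>

lemma card_subsets_containing:
  assumes "finite S" "e \<in> S"
  shows "card {X. X \<subseteq> S \<and> e \<in> X} = 2 ^ (card S - 1)"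
proof -
  have "bij_betw (insert e) (Pow (S - {e})) {X. X \<subseteq> S \<and> e \<in> X}"
    by (rule bij_betwI[where g = "\<lambda>X. X - {e}"]) (use assms in auto)
  then show ?thesis
    using assms by (simp add: bij_betw_same_card[symmetric] card_Pow)
qed

text \<open>Inclusion-exclusion after replacing members without \<open>e\<close> by their
  complements: the first summand counts the pairs that \<open>F\<close> meets, the second those it
  meets twice.\<close>

lemma card_eq_cover_plus_paired:
  assumes "finite S" "e \<in> S" "F \<subseteq> Pow S"
  shows "card F = card {X. X \<subseteq> S \<and> e \<in> X \<and> (X \<in> F \<or> S - X \<in> F)} + card (paired S e F)"
proof -
  let ?A = "{X \<in> F. e \<in> X}" and ?B = "{X. X \<subseteq> S \<and> e \<in> X \<and> S - X \<in> F}"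
  have finF: "finite F" using assms finite_subset by blast
  have finB: "finite ?B" using assms(1) by (auto intro: finite_subset[of _ "Pow S"])
  have "bij_betw (\<lambda>X. S - X) ?B {X \<in> F. e \<notin> X}"
    by (rule bij_betwI[where g = "\<lambda>X. S - X"]) (use assms in \<open>auto simp: double_diff\<close>)
  then have cB: "card ?B = card {X \<in> F. e \<notin> X}"
    by (rule bij_betw_same_card)
  have "card F = card (?A \<union> {X \<in> F. e \<notin> X})"
    by (rule arg_cong[where f = card]) auto
  also have "\<dots> = card ?A + card {X \<in> F. e \<notin> X}"
    using finF by (intro card_Un_disjoint) auto
  also have "\<dots> = card ?A + card ?B" using cB by simp
  also have "\<dots> = card (?A \<union> ?B) + card (?A \<inter> ?B)"
    using finF finB by (intro card_Un_Int) auto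
  also have "?A \<union> ?B = {X. X \<subseteq> S \<and> e \<in> X \<and> (X \<in> F \<or> S - X \<in> F)}" using assms(3) by auto
  also have "?A \<inter> ?B = paired S e F" using assms(3) by (auto simp: paired_def)
  finally show ?thesis .
qed

lemma card_le_paired:
  assumes "finite S" "e \<in> S" "F \<subseteq> Pow S"
  shows "card F \<le> 2 ^ (card S - 1) + card (paired S e F)"
proof -
  have "card {X. X \<subseteq> S \<and> e \<in> X \<and> (X \<in> F \<or> S - X \<in> F)} \<le> card {X. X \<subseteq> S \<and> e \<in> X}"
    by (rule card_mono) (use assms(1) in \<open>auto intro: finite_subset[of _ "Pow S"]\<close>)
  then show ?thesis
    using card_eq_cover_plus_paired[OF assms] card_subsets_containing[OF assms(1,2)] by simp
qed

lemma card_eq_paired: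
  assumes "finite S" "e \<in> S" "F \<subseteq> Pow S" "covers_pairs S F"
  shows "card F = 2 ^ (card S - 1) + card (paired S e F)"
proof -
  have "{X. X \<subseteq> S \<and> e \<in> X \<and> (X \<in> F \<or> S - X \<in> F)} = {X. X \<subseteq> S \<and> e \<in> X}"
    using assms(4) by (auto simp: covers_pairs_def)
  then show ?thesis
    using card_eq_cover_plus_paired[OF assms(1-3)] card_subsets_containing[OF assms(1,2)] by simp
qed

section \<open>Comparing intersecting subfamilies\<close>

text \<open>As \<open>A\<close> meets every pair, it contains the least number of full pairs
  possible at its size. Its full pairs therefore inject into those of \<open>F\<close>, and equal
  cardinality lets the remaining members be matched arbitrarily.\<close>

lemma bij_betw_reflecting_complements:
  assumes "finite S" "e \<in> S" "A \<subseteq> Pow S" "F \<subseteq> Pow S" "card F = card A"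
    and "covers_pairs S A"
  obtains h where "bij_betw h A F" "\<And>X. X \<in> A \<Longrightarrow> S - X \<in> A \<Longrightarrow> h (S - X) = S - h X"
proof -
  have finA: "finite A" and finF: "finite F"
    using assms finite_subset by blast+
  have finp: "finite (paired S e A)" "finite (paired S e F)"
    using finA finF by (auto simp: paired_def)
  have "card (paired S e A) \<le> card (paired S e F)"
    using card_eq_paired[OF assms(1-3,6)] card_le_paired[OF assms(1,2,4)] assms(5) by simp
  then obtain f where f: "f ` paired S e A \<subseteq> paired S e F" "inj_on f (paired S e A)"
    using card_le_inj[OF finp] by blast
  define P where "P = {X \<in> A. S - X \<in> A}"
  \<comment> \<open>\<open>f\<close> acts only on the representatives containing \<open>e\<close>;
    \<open>g\<close> extends it to their partners so as to commute with complement.\<close>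
  define g where "g X = (if e \<in> X then f X else S - f (S - X))" for X
  have dd: "S - (S - X) = X" if "X \<in> A \<or> X \<in> F" for X
    using that assms(3,4) by auto
  have fX: "f X \<in> F" "e \<in> f X" "S - f X \<in> F" if "X \<in> A" "e \<in> X" "S - X \<in> A" for X
    using that f(1) by (auto simp: paired_def)
  have g_compl: "g (S - X) = S - g X" if "X \<in> P" for X
  proof (cases "e \<in> X")
    case True
    moreover have "S - (S - X) = X" using that dd by (simp add: P_def)
    ultimately show ?thesis by (simp add: g_def)
  next
    case False
    then have "f (S - X) \<in> F" using fX(1)[of "S - X"] that assms(2) dd[of X] by (simp add: P_def)
    then have "S - (S - f (S - X)) = f (S - X)" using dd by simp
    then show ?thesis using False assms(2) by (simp add: g_def)
  qed
  have e_g: "e \<in> g X \<longleftrightarrow> e \<in> X" and g_F: "g X \<in> F" if "X \<in> P" for X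
    using that fX[of X] fX[of "S - X"] assms(2) dd[of X] by (auto simp: g_def P_def)
  have g_inj: "inj_on g P"
  proof (rule inj_onI)
    fix X Y assume XY: "X \<in> P" "Y \<in> P" "g X = g Y"
    then have eXY: "e \<in> X \<longleftrightarrow> e \<in> Y" using e_g by metis
    show "X = Y"
    proof (cases "e \<in> X")
      case True
      then show ?thesis
        using XY eXY inj_onD[OF f(2), of X Y] by (auto simp: g_def P_def paired_def)
    next
      case False
      have m: "S - X \<in> paired S e A" "S - Y \<in> paired S e A"
        using XY False eXY assms(2) dd[of X] dd[of Y] by (auto simp: P_def paired_def)
      have "g (S - X) = g (S - Y)" using XY g_compl by simp
      then have "f (S - X) = f (S - Y)" using False eXY assms(2) by (simp add: g_def)
      then have "S - X = S - Y" using inj_onD[OF f(2)] m by blast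
      moreover have "S - (S - X) = X" "S - (S - Y) = Y" using dd XY by (simp_all add: P_def)
      ultimately show ?thesis by metis
    qed
  qed
  have "P \<subseteq> A" by (auto simp: P_def)
  have gP: "g ` P \<subseteq> F" using g_F by auto
  have "card (A - P) = card (F - g ` P)"
    using \<open>P \<subseteq> A\<close> gP finA finF assms(5) g_inj
    by (simp add: card_Diff_subset finite_subset card_image)
  then obtain k where k: "bij_betw k (A - P) (F - g ` P)"
    using finite_same_card_bij[of "A - P" "F - g ` P"] finA finF by auto
  define h where "h X = (if X \<in> P then g X else k X)" for X
  have hP: "bij_betw h P (g ` P)"
    using g_inj by (simp add: bij_betw_def inj_on_def h_def)
  have hQ: "bij_betw h (A - P) (F - g ` P)"
    using k by (rule bij_betw_cong[THEN iffD1, rotated]) (auto simp: h_def)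
  have "bij_betw h (P \<union> (A - P)) (g ` P \<union> (F - g ` P))"
    by (rule bij_betw_combine[OF hP hQ]) auto
  moreover have "P \<union> (A - P) = A" "g ` P \<union> (F - g ` P) = F"
    using \<open>P \<subseteq> A\<close> gP by auto
  ultimately have "bij_betw h A F" by simp
  moreover have "h (S - X) = S - h X" if "X \<in> A" "S - X \<in> A" for X
  proof -
    have "X \<in> P" "S - X \<in> P" using that dd[of X] by (auto simp: P_def)
    then show ?thesis using g_compl by (simp add: h_def)
  qed
  ultimately show thesis by (rule that)
qed

text \<open>The inverse of the bijection carries intersecting subfamilies of \<open>F\<close>
  injectively to intersecting subfamilies of \<open>A\<close>: disjoint images would be
  complementary in \<open>A\<close>, and \<open>h\<close> would take them back to complementary,
  hence disjoint, sets.\<close>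

lemma intersecting_count_le:
  assumes "finite S" "e \<in> S" "A \<subseteq> Pow S" "F \<subseteq> Pow S" "card F = card A"
    and "covers_pairs S A" "only_complementary_disjoint S A"
  shows "intersecting_count F s \<le> intersecting_count A s"
proof -
  obtain h where h: "bij_betw h A F"
    and hc: "\<And>X. X \<in> A \<Longrightarrow> S - X \<in> A \<Longrightarrow> h (S - X) = S - h X"
    using bij_betw_reflecting_complements[OF assms(1-6)] by blast
  define k where "k = inv_into A h"
  have k: "bij_betw k F A"
    using h by (simp add: k_def bij_betw_inv_into)
  have hk: "h (k X) = X" if "X \<in> F" for X
    using that h by (simp add: k_def bij_betw_inv_into_right)
  have kinj: "inj_on k F" using k bij_betw_def by blast
  have kA: "k X \<in> A" if "X \<in> F" for X using that k by (rule bij_betwE[rule_format, rotated])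
  have finA: "finite A" using assms finite_subset by blast
  have int: "intersecting (k ` G)" if G: "G \<subseteq> F" "intersecting G" for G
    unfolding intersecting_def
  proof (intro ballI notI, elim imageE)
    fix X' Y' X Y assume *: "X' \<inter> Y' = {}" "X' = k X" "X \<in> G" "Y' = k Y" "Y \<in> G"
    then have "X \<in> F" "Y \<in> F" using G by auto
    then have "k Y = S - k X"
      using * kA assms(7) by (auto simp: only_complementary_disjoint_def)
    then have "h (k Y) = S - h (k X)" using hc kA \<open>X \<in> F\<close> \<open>Y \<in> F\<close> by metis
    then have "Y = S - X" using hk \<open>X \<in> F\<close> \<open>Y \<in> F\<close> by simp
    then show False using * G(2) by (auto simp: intersecting_def)
  qed
  have "inj_on ((`) k) {G. G \<subseteq> F \<and> card G = s \<and> intersecting G}"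
    using kinj by (auto simp: inj_on_def[of "(`) k"] inj_on_image_eq_iff)
  moreover have "(`) k ` {G. G \<subseteq> F \<and> card G = s \<and> intersecting G}
      \<subseteq> {G. G \<subseteq> A \<and> card G = s \<and> intersecting G}"
  proof (rule image_subsetI, clarify)
    fix G assume "G \<subseteq> F" "intersecting G"
    moreover from this have "card (k ` G) = card G"
      using kinj card_image inj_on_subset by blast
    ultimately show "k ` G \<subseteq> A \<and> card (k ` G) = card G \<and> intersecting (k ` G)"
      using int kA by auto
  qed
  moreover have "finite {G. G \<subseteq> A \<and> card G = s \<and> intersecting G}"
    using finA by (auto intro: finite_subset[of _ "Pow A"])
  ultimately show ?thesis
    unfolding intersecting_count_def by (rule card_inj_on_le)
qed

section \<open>Cutting down to a prescribed size\<close>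

lemma covering_subfamily:
  assumes "finite S" "e \<in> S" "M \<subseteq> Pow S" "covers_pairs S M" "Z \<in> M"
    and "2 ^ (card S - 1) < N" "N \<le> card M"
  obtains A where "A \<subseteq> M" "Z \<in> A" "card A = N" "covers_pairs S A"
proof -
  \<comment> \<open>\<open>U\<close> takes exactly one member of every pair, preferring the one with
    \<open>e\<close> when \<open>M\<close> contains both.\<close>
  define U where "U = {X \<in> M. S - X \<in> M \<longrightarrow> e \<in> X}"
  have dd: "S - (S - X) = X" if "X \<subseteq> S" for X using that by auto
  have covU: "covers_pairs S U"
    using assms(2,4) dd by (auto simp: covers_pairs_def U_def)
  have "paired S e U = {}"
    using assms(2,3) dd by (auto simp: paired_def U_def)
  moreover have US: "U \<subseteq> Pow S" using assms(3) by (auto simp: U_def)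
  ultimately have "card U = 2 ^ (card S - 1)"
    using card_eq_paired[OF assms(1,2) US covU] by simp
  \<comment> \<open>If \<open>U\<close> omits \<open>Z\<close>, restoring it costs one set, which
    the strict bound on \<open>N\<close> allows.\<close>
  moreover have "card (insert Z U) \<le> Suc (card U)" by (rule card_insert_le_m1) auto
  ultimately have "card (insert Z U) \<le> N" using assms(6) by simp
  moreover have "insert Z U \<subseteq> M" using assms(5) by (auto simp: U_def)
  moreover have "finite M" using assms(1,3) finite_subset by blast
  ultimately obtain A where "insert Z U \<subseteq> A" "A \<subseteq> M" "card A = N"
    using exists_subset_between[of "insert Z U" N M] assms(7) by blast
  moreover from this have "covers_pairs S A"
    using covU by (auto simp: covers_pairs_def)
  ultimately show thesis using that by blast
qed

section \<open>The maximal family through a small set\<close>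

text \<open>The condition on \<open>e\<close> is vacuous when \<open>card S = 2 * t\<close>. When
  \<open>card S = 2 * t + 1\<close> it concerns only sets of size \<open>t\<close>, two of which
  could otherwise be disjoint without being complementary.\<close>

definition small_set_family :: "'a set \<Rightarrow> nat \<Rightarrow> 'a set \<Rightarrow> 'a \<Rightarrow> 'a set set" where
  "small_set_family S t Z e = {X. X \<subseteq> S \<and> (X = Z \<or> X = S - Z \<or>
     t \<le> card X \<and> X \<inter> Z \<noteq> {} \<and> (2 * card X < card S \<longrightarrow> e \<in> X))}"

context
  fixes S Z :: "'a set" and e :: 'a and t :: nat
  assumes finS: "finite S"
    and cardS: "card S = 2 * t \<or> card S = 2 * t + 1"
    and ZS: "Z \<subseteq> S" and eZ: "e \<in> Z" and cardZ: "Suc (card Z) = t"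
begin

lemma card_compl: "X \<subseteq> S \<Longrightarrow> card X + card (S - X) = card S"
  using finS by (metis card_Diff_subset card_mono finite_subset le_add_diff_inverse)

text \<open>Take the member of the pair with at least half of the points. It is missing only if it
  lies properly inside \<open>S - Z\<close>; its complement then properly contains \<open>Z\<close>,
  so it has at least \<open>t\<close> points, one of them \<open>e\<close>.\<close>

lemma small_set_family_covers_pairs:
  "covers_pairs S (small_set_family S t Z e)" (is "covers_pairs S ?M")
proof -
  have large: "X \<in> ?M \<or> S - X \<in> ?M" if XS: "X \<subseteq> S" and X: "card S \<le> 2 * card X" for X
  proof (cases "X \<inter> Z = {} \<and> X \<noteq> S - Z")
    case True
    then have "X \<subset> S - Z" using XS by auto
    then have "card X < card (S - Z)" using finS by (simp add: psubset_card_mono)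
    then have "t \<le> card (S - X)"
      using card_compl[OF XS] card_compl[OF ZS] cardZ by linarith
    moreover have "e \<in> S - X" using True eZ ZS by auto
    ultimately have "S - X \<in> ?M" using eZ unfolding small_set_family_def by blast
    then show ?thesis ..
  next
    case False
    moreover have "t \<le> card X" using X cardS by linarith
    ultimately have "X \<in> ?M" using XS X by (auto simp: small_set_family_def)
    then show ?thesis ..
  qed
  have "X \<in> ?M \<or> S - X \<in> ?M" if XS: "X \<subseteq> S" for X
  proof (cases "card S \<le> 2 * card X")
    case True
    then show ?thesis using large XS by blast
  next
    case False
    then have "card S \<le> 2 * card (S - X)" using card_compl[OF XS] by linarith
    then have "S - X \<in> ?M \<or> S - (S - X) \<in> ?M" by (intro large) auto
    then show ?thesis using XS by (auto simp: double_diff)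
  qed
  then show ?thesis by (auto simp: covers_pairs_def)
qed

text \<open>Only \<open>S - Z\<close> misses \<open>Z\<close>, and only \<open>Z\<close> lies inside
  \<open>Z\<close>. Any other two disjoint members have sizes adding up to at least
  \<open>card S\<close>, so they are complementary.\<close>

lemma small_set_family_only_complementary_disjoint:
  "only_complementary_disjoint S (small_set_family S t Z e)"
  unfolding only_complementary_disjoint_def
proof (intro ballI impI)
  fix X Y
  assume X: "X \<in> small_set_family S t Z e" and Y: "Y \<in> small_set_family S t Z e"
    and XY: "X \<inter> Y = {}"
  have YS: "Y \<subseteq> S" and XS: "X \<subseteq> S" using X Y by (auto simp: small_set_family_def)
  have finZ: "finite Z" using ZS finS finite_subset by blast
  have notsub: "\<not> W \<subseteq> Z" if "t \<le> card W" for W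
    using card_mono[OF finZ, of W] that cardZ by auto
  \<comment> \<open>Needed to exclude that \<open>S - Z\<close> itself lies inside
    \<open>Z\<close>.\<close>
  have "t \<le> card (S - Z)" using card_compl[OF ZS] cardS cardZ by auto
  then have "S - Z \<noteq> {}" using cardZ by (metis Suc_n_not_le_n card.empty le_trans not_less_eq_eq zero_le)
  consider "X = Z" | "X = S - Z" | "Y = Z" | "Y = S - Z"
    | "t \<le> card X" "2 * card X < card S \<longrightarrow> e \<in> X" "t \<le> card Y" "2 * card Y < card S \<longrightarrow> e \<in> Y"
    using X Y by (auto simp: small_set_family_def)
  then show "Y = S - X"
  proof cases
    case 1
    then show ?thesis using XY Y eZ by (auto simp: small_set_family_def)
  next
    case 2
    then have "Y \<subseteq> Z" using XY YS by auto
    then have "Y = Z"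
      using Y notsub[of Y] \<open>S - Z \<noteq> {}\<close> by (auto simp: small_set_family_def)
    then show ?thesis using 2 ZS by auto
  next
    case 3
    then show ?thesis using XY X eZ ZS by (auto simp: small_set_family_def)
  next
    case 4
    then have "X \<subseteq> Z" using XY XS by auto
    then have "X = Z"
      using X notsub[of X] \<open>S - Z \<noteq> {}\<close> by (auto simp: small_set_family_def)
    then show ?thesis using 4 by auto
  next
    case 5
    \<comment> \<open>If both sets were smaller than half of \<open>S\<close>, they would share
      \<open>e\<close>.\<close>
    then have "\<not> (2 * card X < card S \<and> 2 * card Y < card S)" using XY by auto
    then have "card S \<le> card X + card Y" using 5 cardS by linarith
    then have "card (S - X) \<le> card Y" using card_compl[OF XS] by linarith
    moreover have "Y \<subseteq> S - X" using XY YS by auto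
    ultimately show ?thesis using finS by (simp add: card_seteq)
  qed
qed

text \<open>The pair of \<open>Z\<close> is full, and so is the pair of each \<open>t\<close>-set
  through \<open>e\<close> that does not contain \<open>Z\<close>. The \<open>t\<close>-sets
  containing \<open>Z\<close> are \<open>Z\<close> plus one point, \<open>card S - t + 1\<close> in
  number. The bound is stated additively to avoid truncated subtraction.\<close>

lemma card_small_set_family:
  "2 ^ (card S - 1) + 1 + ((card S - 1) choose (t - 1))
     \<le> card (small_set_family S t Z e) + (card S - t + 1)"
proof -
  let ?M = "small_set_family S t Z e"
  let ?T = "{X. X \<subseteq> S \<and> card X = t \<and> e \<in> X}"
  have finZ: "finite Z" using ZS finS finite_subset by blast
  have eS: "e \<in> S" using eZ ZS by auto
  have finP: "finite (paired S e ?M)"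
    using finS by (auto simp: paired_def small_set_family_def intro: finite_subset[of _ "Pow S"])
  have finT: "finite ?T"
    using finS by (auto intro: finite_subset[of _ "Pow S"])
  have finX: "finite X" if "X \<subseteq> S" for X using finS that finite_subset by blast
  have "bij_betw (insert e) {X. X \<subseteq> S - {e} \<and> card X = t - 1} ?T"
    by (rule bij_betwI[where g = "\<lambda>X. X - {e}"])
      (use eS cardZ finX finS in \<open>auto simp: subset_Diff_insert card_insert_disjoint finite_subset\<close>)
  then have cT: "card ?T = (card S - 1) choose (t - 1)"
    using finS eS by (simp add: bij_betw_same_card[symmetric] n_subsets)
  have "Z \<notin> ?T" using cardZ by auto
  have "insert Z ?T \<subseteq> paired S e ?M \<union> (\<lambda>y. insert y Z) ` (S - Z)"
  proof
    fix X assume "X \<in> insert Z ?T"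
    then consider "X = Z" | "X \<in> ?T" "Z \<subseteq> X" | "X \<in> ?T" "\<not> Z \<subseteq> X" by blast
    then show "X \<in> paired S e ?M \<union> (\<lambda>y. insert y Z) ` (S - Z)"
    proof cases
      case 1
      then show ?thesis using ZS eZ by (auto simp: paired_def small_set_family_def)
    next
      case 2
      then have "card (X - Z) = 1"
        using cardZ finZ by (auto simp: card_Diff_subset)
      then obtain y where "X - Z = {y}" by (rule card_1_singletonE)
      then have "X = insert y Z" "y \<in> S - Z" using 2 by auto
      then show ?thesis by auto
    next
      case 3
      \<comment> \<open>Since \<open>Z\<close> is not inside \<open>X\<close>, the complement meets
        \<open>Z\<close>; it has at least half of the points, so the condition on \<open>e\<close>
        does not restrict it.\<close>
      then have "card X + card (S - X) = card S" using card_compl by auto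
      then have "t \<le> card (S - X)" "\<not> 2 * card (S - X) < card S" using 3 cardS by auto
      then show ?thesis using 3 ZS eZ by (auto simp: paired_def small_set_family_def)
    qed
  qed
  then have "card (insert Z ?T) \<le> card (paired S e ?M \<union> (\<lambda>y. insert y Z) ` (S - Z))"
    using finP finS by (intro card_mono) auto
  also have "\<dots> \<le> card (paired S e ?M) + card ((\<lambda>y. insert y Z) ` (S - Z))"
    by (rule card_Un_le)
  also have "\<dots> \<le> card (paired S e ?M) + card (S - Z)"
    using finS by (simp add: card_image_le)
  also have "card (S - Z) = card S - t + 1"
    using card_compl[OF ZS] cardZ cardS by auto
  finally have "1 + card ?T \<le> card (paired S e ?M) + (card S - t + 1)"
    using \<open>Z \<notin> ?T\<close> finT by simp
  moreover have "card ?M = 2 ^ (card S - 1) + card (paired S e ?M)"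
    by (rule card_eq_paired[OF finS eS _ small_set_family_covers_pairs])
      (auto simp: small_set_family_def)
  ultimately show ?thesis using cT by simp
qed

end

section \<open>Both cases of the theorem\<close>

theorem theorem13:
  fixes n t N :: nat
  assumes "t \<ge> 1"
    and "(n = 2 * t \<and> 2 ^ (n - 1) < real N
            \<and> real N \<le> 2 ^ (n - 1) + 1 / 2 * real (n choose t) - real t)
       \<or> (n = 2 * t + 1 \<and> 2 ^ (n - 1) < real N
            \<and> real N \<le> 2 ^ (n - 1) + real ((n - 1) choose (t - 1)) - real t - 1)"
  shows "\<exists>\<A>. \<A> \<subseteq> Pow {1..n} \<and> card \<A> = N
      \<and> (\<forall>s. \<forall>\<F>. \<F> \<subseteq> Pow {1..n} \<and> card \<F> = N
              \<longrightarrow> intersecting_count \<F> s \<le> intersecting_count \<A> s)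
      \<and> \<not> (\<exists>\<B>. \<B> \<subseteq> [{1..n}]\<^bsup>t\<^esup> \<and> \<A> = subsets_ge {1..n} (t + 1) \<union> \<B>)"
proof -
  \<comment> \<open>For \<open>t = 1\<close> both ranges for \<open>N\<close> are empty; from
    \<open>t = 2\<close> on, a set of size \<open>t - 1\<close> can contain a point
    \<open>e\<close>.\<close>
  have t2: "t \<ge> 2"
  proof (rule ccontr)
    assume "\<not> t \<ge> 2"
    then have "t = 1" using assms(1) by simp
    then show False using assms(2) by auto
  qed
  have n: "n = 2 * t \<or> n = 2 * t + 1" using assms(2) by auto
  have "real (2 ^ (n - 1)) < real N" using assms(2) by auto
  then have N_gt: "2 ^ (n - 1) < N" by (simp only: of_nat_less_iff)
  \<comment> \<open>This turns half the central binomial coefficient of case (i) into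
    \<open>(n - 1) choose (t - 1)\<close>, the number of \<open>t\<close>-sets through a fixed
    point.\<close>
  have half: "(2 * t) choose t = 2 * ((2 * t - 1) choose (t - 1))"
  proof -
    obtain k where "t = Suc k" using t2 by (cases t) auto
    moreover have "(2 * k + 1) choose Suc k = (2 * k + 1) choose k"
      using binomial_symmetric[of k "2 * k + 1"] by simp
    ultimately show ?thesis by simp
  qed
  \<comment> \<open>Both upper bounds become
    \<open>N \<le> 2 ^ (n - 1) + ((n - 1) choose (t - 1)) - (n - t)\<close>, which is the lower
    bound on the size of the family through \<open>Z\<close>.\<close>
  have "real N + real (n - t + 1) \<le> real (2 ^ (n - 1) + 1 + ((n - 1) choose (t - 1)))"
    using assms(2)
  proof (elim disjE conjE)
    assume "n = 2 * t" "real N \<le> 2 ^ (n - 1) + 1 / 2 * real (n choose t) - real t"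
    then show ?thesis using half by simp
  next
    assume "n = 2 * t + 1" "real N \<le> 2 ^ (n - 1) + real ((n - 1) choose (t - 1)) - real t - 1"
    then show ?thesis by simp
  qed
  then have N_le: "N + (n - t + 1) \<le> 2 ^ (n - 1) + 1 + ((n - 1) choose (t - 1))"
    by (simp only: of_nat_add[symmetric] of_nat_le_iff)

  define S where "S = {1..n}"
  define Z where "Z = {1..t - 1}"
  define M where "M = small_set_family S t Z 1"
  have S: "finite S" "card S = n" by (auto simp: S_def)
  have cS: "card S = 2 * t \<or> card S = 2 * t + 1" using S n by simp
  have Z: "Z \<subseteq> S" "1 \<in> Z" "Suc (card Z) = t" using t2 n by (auto simp: Z_def S_def)
  then have 1: "1 \<in> S" by auto
  note M_props = S(1) cS Z
  have cov: "covers_pairs S M" and ocd: "only_complementary_disjoint S M"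
    unfolding M_def using small_set_family_covers_pairs[OF M_props]
      small_set_family_only_complementary_disjoint[OF M_props] by auto
  have MS: "M \<subseteq> Pow S" and ZM: "Z \<in> M" using Z by (auto simp: M_def small_set_family_def)
  have "N \<le> card M"
    using N_le card_small_set_family[OF M_props] S(2) by (simp add: M_def)
  then obtain A where A: "A \<subseteq> M" "Z \<in> A" "card A = N" "covers_pairs S A"
    using covering_subfamily[OF S(1) 1 MS cov ZM] N_gt S(2) by metis
  have AS: "A \<subseteq> Pow S" using A MS by auto
  have "only_complementary_disjoint S A"
    using ocd A(1) by (auto simp: only_complementary_disjoint_def)
  then have "intersecting_count F s \<le> intersecting_count A s" if "F \<subseteq> Pow S" "card F = N" for F s
    using intersecting_count_le[OF S(1) 1 AS that(1)] that(2) A by simp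
  \<comment> \<open>The excluded families have only members of size at least \<open>t\<close>, while
    \<open>Z\<close> has size \<open>t - 1\<close>.\<close>
  moreover have "Z \<notin> subsets_ge S (t + 1) \<union> B" if "B \<subseteq> [S]\<^bsup>t\<^esup>" for B
    using that Z(3) by (auto simp: subsets_ge_def nsets_def)
  then have "\<nexists>B. B \<subseteq> [S]\<^bsup>t\<^esup> \<and> A = subsets_ge S (t + 1) \<union> B"
    using A(2) by metis
  ultimately show ?thesis
    using AS A(3) unfolding S_def by (intro exI[of _ A]) simp
qed

end
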